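(* Let $P$ be a Borel probability measure on $\mathbb{X}$ and let $\mathcal{Q}$ be a set of channels from $\mathbb{X}$ to $\mathbb{Y}$ such that $\{PQ:\ Q\in\mathcal{Q}\}$ is a precompact set of probability measures under total variation. Then $\mathcal{Q}$ is precompact under total variation at input $P$.
   Context: $\mathbb{X}=\mathbb{R}^n$, $\mathbb{Y}=\mathbb{R}^m$. A channel $Q$ is a stochastic kernel from $\mathbb{X}$ to $\mathbb{Y}$: $Q(\cdot|x)$ is a Borel probability measure on $\mathbb{Y}$ for every $x\in\mathbb{X}$, and $x\mapsto Q(A|x)$ is Borel measurable for every Borel $A\subset\mathbb{Y}$. $PQ$ is the joint probability measure on $\mathbb{X}\times\mathbb{Y}$ given by $PQ(A)=\int_A Q(dy|x)P(dx)$. $\|\mu-\nu\|_{TV}=2\sup_B|\mu(B)-\nu(B)|$, supremum over Borel sets. A set of probability measures is precompact under total variation if every sequence in it has a subsequence converging in total variation to some probability measure (not necessarily in the set). A set $\mathcal{Q}$ of channels is precompact under total variation at input $P$ if every sequence in $\mathcal{Q}$ has a subsequence $\{Q_n\}$ such that $\|PQ_n-PQ\|_{TV}\to0$ for some channel $Q$ from $\mathbb{X}$ to $\mathbb{Y}$ (not necessarily in $\mathcal{Q}$). *)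

theory Defs
  imports "HOL-Probability.Probability"
begin

definition borel_prob :: "'a::topological_space measure \<Rightarrow> bool" where
  "borel_prob \<mu> \<longleftrightarrow> prob_space \<mu> \<and> sets \<mu> = sets borel"

definition channel :: "('a::topological_space \<Rightarrow> 'b::topological_space measure) \<Rightarrow> bool" where
  "channel Q \<longleftrightarrow>
     (\<forall>x. borel_prob (Q x)) \<and>
     (\<forall>A\<in>sets borel. (\<lambda>x. emeasure (Q x) A) \<in> borel_measurable borel)"

lemma channel_iff_measurable_prob_algebra:
  "channel Q \<longleftrightarrow> Q \<in> borel \<rightarrow>\<^sub>M prob_algebra borel"
proof
  assume "channel Q"
  then have "prob_space (Q x)" and "sets (Q x) = sets borel"
    and "A \<in> sets borel \<Longrightarrow> (\<lambda>x. emeasure (Q x) A) \<in> borel_measurable borel" for x A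
    by (auto simp: channel_def borel_prob_def)
  then show "Q \<in> borel \<rightarrow>\<^sub>M prob_algebra borel"
    by (intro measurable_prob_algebraI measurable_subprob_algebra)
       (auto intro: prob_space_imp_subprob_space)
next
  assume Q: "Q \<in> borel \<rightarrow>\<^sub>M prob_algebra borel"
  have "Q x \<in> space (prob_algebra borel)" for x
    using measurable_space[OF Q] by simp
  moreover have "(\<lambda>x. emeasure (Q x) A) \<in> borel_measurable borel" if "A \<in> sets borel" for A
    using measurable_emeasure_kernel[OF measurable_prob_algebraD[OF Q] that] .
  ultimately show "channel Q"
    by (auto simp: channel_def borel_prob_def space_prob_algebra)
qed

text \<open>The joint measure \<open>PQ\<close>. If the set function below were not countably additive,
  \<^const>\<open>measure_of\<close> would return the zero measure; \<open>emeasure_joint\<close> shows that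
  this does not happen for a Borel probability measure and a channel.\<close>

definition joint ::
  "'a::topological_space measure \<Rightarrow> ('a \<Rightarrow> 'b::topological_space measure) \<Rightarrow> ('a \<times> 'b) measure"
where
  "joint P Q = measure_of UNIV (sets borel)
     (\<lambda>A. \<integral>\<^sup>+ x. (\<integral>\<^sup>+ y. indicator A (x, y) \<partial>Q x) \<partial>P)"

lemma space_joint [simp]: "space (joint P Q) = UNIV"
  by (simp add: joint_def space_measure_of_conv)

lemma sets_joint [simp, measurable_cong]: "sets (joint P Q) = sets borel"
  using sets.sets_measure_of_eq[of borel] by (simp add: joint_def)

lemma joint_eq_bind:
  fixes P :: "'a::second_countable_topology measure"
    and Q :: "'a \<Rightarrow> 'b::second_countable_topology measure"
  assumes P: "borel_prob P" and Q: "channel Q"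
  shows "joint P Q = P \<bind> (\<lambda>x. Q x \<bind> (\<lambda>y. return borel (x, y)))" (is "_ = ?B")
    and "A \<in> sets borel \<Longrightarrow>
      emeasure (joint P Q) A = (\<integral>\<^sup>+ x. (\<integral>\<^sup>+ y. indicator A (x, y) \<partial>Q x) \<partial>P)"
    and "borel_prob (joint P Q)"
proof -
  have sP [measurable_cong]: "sets P = sets borel" and "prob_space P"
    using P by (auto simp: borel_prob_def)
  then have Pp: "P \<in> space (prob_algebra borel)"
    by (simp add: space_prob_algebra)
  have Qm [measurable]: "Q \<in> borel \<rightarrow>\<^sub>M prob_algebra borel"
    using Q by (simp add: channel_iff_measurable_prob_algebra)
  have sQ [measurable_cong]: "sets (Q x) = sets borel" for x
    using Q by (auto simp: channel_def borel_prob_def)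
  have ret [measurable]:
    "(\<lambda>z. return borel z) \<in> (borel :: ('a \<times> 'b) measure) \<rightarrow>\<^sub>M prob_algebra borel"
    by (rule measurable_return_prob_space)
  have K [measurable]: "(\<lambda>x. Q x \<bind> (\<lambda>y. return borel (x, y))) \<in>
      borel \<rightarrow>\<^sub>M (prob_algebra borel :: ('a \<times> 'b) measure measure)"
    by (rule measurable_bind_prob_space2[where N = borel]) measurable
  have sB: "sets ?B = sets borel"
    using sets_bind'[OF Pp K] .
  have pB: "prob_space ?B"
    using prob_space_bind'[OF Pp K] .
  have eB: "emeasure ?B A = (\<integral>\<^sup>+ x. (\<integral>\<^sup>+ y. indicator A (x, y) \<partial>Q x) \<partial>P)"
    if A [measurable]: "A \<in> sets borel" for A
  proof -
    have "emeasure ?B A = (\<integral>\<^sup>+ x. emeasure (Q x \<bind> (\<lambda>y. return borel (x, y))) A \<partial>P)"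
      by (rule emeasure_bind_prob_algebra[OF Pp K A])
    also have "\<dots> = (\<integral>\<^sup>+ x. (\<integral>\<^sup>+ y. indicator A (x, y) \<partial>Q x) \<partial>P)"
    proof (rule nn_integral_cong)
      fix x
      have "Q x \<in> space (prob_algebra borel)"
        using measurable_space[OF Qm] by simp
      moreover have "(\<lambda>y. return borel (x, y)) \<in>
          borel \<rightarrow>\<^sub>M (prob_algebra borel :: ('a \<times> 'b) measure measure)"
        by measurable
      ultimately have "emeasure (Q x \<bind> (\<lambda>y. return borel (x, y))) A
          = (\<integral>\<^sup>+ y. emeasure (return borel (x, y)) A \<partial>Q x)"
        using A by (rule emeasure_bind_prob_algebra)
      then show "emeasure (Q x \<bind> (\<lambda>y. return borel (x, y))) A
          = (\<integral>\<^sup>+ y. indicator A (x, y) \<partial>Q x)"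
        by simp
    qed
    finally show ?thesis .
  qed
  have "?B = measure_of (space ?B) (sets ?B) (emeasure ?B)"
    by (rule measure_of_of_measure[symmetric])
  also have "\<dots> = measure_of UNIV (sets borel) (emeasure ?B)"
    using sB sets_eq_imp_space_eq[OF sB] by simp
  also have "\<dots> = joint P Q"
    unfolding joint_def using eB sets.sets_measure_of_eq[of borel]
    by (intro measure_of_eq) (auto simp: sets.sigma_sets_eq[of borel, simplified])
  finally show eq: "joint P Q = ?B" ..
  show "emeasure (joint P Q) A = (\<integral>\<^sup>+ x. (\<integral>\<^sup>+ y. indicator A (x, y) \<partial>Q x) \<partial>P)"
    if "A \<in> sets borel"
    using eB[OF that] by (simp add: eq)
  show "borel_prob (joint P Q)"
    using sB pB by (simp add: eq borel_prob_def)
qed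

lemmas emeasure_joint = joint_eq_bind(2)
lemmas borel_prob_joint = joint_eq_bind(3)

definition tv_dist :: "'a::topological_space measure \<Rightarrow> 'a measure \<Rightarrow> real" where
  "tv_dist \<mu> \<nu> = 2 * (SUP B\<in>sets borel. \<bar>measure \<mu> B - measure \<nu> B\<bar>)"

definition tv_precompact :: "'a::topological_space measure set \<Rightarrow> bool" where
  "tv_precompact S \<longleftrightarrow>
     (\<forall>s::nat \<Rightarrow> 'a measure. range s \<subseteq> S \<longrightarrow>
       (\<exists>r \<mu>. strict_mono r \<and> borel_prob \<mu> \<and> (\<lambda>k. tv_dist (s (r k)) \<mu>) \<longlonglongrightarrow> 0))"

definition tv_precompact_at_input ::
  "'a::topological_space measure \<Rightarrow> ('a \<Rightarrow> 'b::topological_space measure) set \<Rightarrow> bool"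
where
  "tv_precompact_at_input P \<Q> \<longleftrightarrow>
     (\<forall>q::nat \<Rightarrow> 'a \<Rightarrow> 'b measure. range q \<subseteq> \<Q> \<longrightarrow>
       (\<exists>r Q. strict_mono r \<and> channel Q \<and>
         (\<lambda>k. tv_dist (joint P (q (r k))) (joint P Q)) \<longlonglongrightarrow> 0))"

end

theory Submission
  imports Defs
begin

text \<open>
  Total variation convergence gives, along a subsequence, a limit \<open>\<mu>\<close> of the joint measures; the
  only question is whether \<open>\<mu>\<close> is again of the form \<open>PQ\<close> for a channel \<open>Q\<close>. A disintegration
  theorem would answer this for any \<open>\<mu>\<close> with first marginal \<open>P\<close>, but here the approximating
  channels \<open>Q\<^sub>n\<close> provide a more elementary route. The mixture \<open>R = \<Sum>\<^sub>n 2\<^bsup>-n-1\<^esup> Q\<^sub>n\<close> is a channel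
  such that a null set of \<open>PR\<close> is null for each \<open>PQ\<^sub>n\<close>, hence also for the limit \<open>\<mu>\<close>
  (\<open>ex_dominating_channel\<close>). By Radon-Nikodym \<open>\<mu>\<close> has a density \<open>f\<close> with respect to \<open>PR\<close>,
  so \<open>f(x, y) R(dy|x)\<close> is a kernel that, together with \<open>P\<close>, reproduces \<open>\<mu>\<close>. Its total mass is
  \<open>1\<close> for \<open>P\<close>-almost all \<open>x\<close> because the first marginal of \<open>\<mu>\<close>, as a limit of measures with first
  marginal \<open>P\<close>, is \<open>P\<close>; on the exceptional null set it may be replaced by \<open>R(dy|x)\<close>
  (\<open>joint_representation_of_absolutely_continuous\<close>).
\<close>

section \<open>Total variation convergence implies setwise convergence\<close>

lemma abs_measure_diff_le_tv_dist:
  assumes "borel_prob \<mu>" and "borel_prob \<nu>" and "A \<in> sets borel"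
  shows "\<bar>measure \<mu> A - measure \<nu> A\<bar> \<le> tv_dist \<mu> \<nu> / 2"
proof -
  interpret M: prob_space \<mu> using assms by (simp add: borel_prob_def)
  interpret N: prob_space \<nu> using assms by (simp add: borel_prob_def)
  have "\<bar>measure \<mu> B - measure \<nu> B\<bar> \<le> 1" for B
    using M.prob_le_1[of B] N.prob_le_1[of B] measure_nonneg[of \<mu> B] measure_nonneg[of \<nu> B]
    by linarith
  then have "bdd_above ((\<lambda>B. \<bar>measure \<mu> B - measure \<nu> B\<bar>) ` sets borel)"
    by (auto intro!: bdd_aboveI[where M = 1])
  from cSUP_upper[OF assms(3) this] show ?thesis
    by (simp add: tv_dist_def)
qed

lemma tv_convergence_imp_setwise:
  assumes "\<And>k. borel_prob (s k)" and "borel_prob \<mu>"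
    and lim: "(\<lambda>k. tv_dist (s k) \<mu>) \<longlonglongrightarrow> 0" and "A \<in> sets borel"
  shows "(\<lambda>k. measure (s k) A) \<longlonglongrightarrow> measure \<mu> A"
proof (rule LIM_zero_cancel, rule Lim_null_comparison)
  show "\<forall>\<^sub>F k in sequentially. norm (measure (s k) A - measure \<mu> A) \<le> tv_dist (s k) \<mu> / 2"
    using abs_measure_diff_le_tv_dist[OF assms(1,2,4)] by simp
  show "(\<lambda>k. tv_dist (s k) \<mu> / 2) \<longlonglongrightarrow> 0"
    using tendsto_divide[OF lim tendsto_const[of 2]] by simp
qed

section \<open>Integration against joint measures\<close>

lemma borel_measurable_section:
  fixes h :: "'a::second_countable_topology \<times> 'b::second_countable_topology \<Rightarrow> ennreal"
  assumes "h \<in> borel_measurable borel"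
  shows "(\<lambda>y. h (x, y)) \<in> borel_measurable borel"
proof -
  have "h \<in> borel_measurable (borel \<Otimes>\<^sub>M borel)"
    using assms by (simp add: borel_prod)
  then show ?thesis by measurable
qed

lemma sets_borel_cylinder:
  fixes A :: "'a::second_countable_topology set"
  assumes "A \<in> sets borel"
  shows "A \<times> UNIV \<in> sets (borel :: ('a \<times> 'b::second_countable_topology) measure)"
  unfolding borel_prod[symmetric] using assms by (intro pair_measureI) auto

lemma nn_integral_joint:
  fixes P :: "'a::second_countable_topology measure"
    and Q :: "'a \<Rightarrow> 'b::second_countable_topology measure"
  assumes P: "borel_prob P" and Q: "channel Q"
    and h [measurable]: "h \<in> borel_measurable borel"
  shows "(\<integral>\<^sup>+ z. h z \<partial>joint P Q) = (\<integral>\<^sup>+ x. (\<integral>\<^sup>+ y. h (x, y) \<partial>Q x) \<partial>P)"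
proof -
  have sP [measurable_cong]: "sets P = sets borel"
    using P by (auto simp: borel_prob_def)
  have Qm [measurable]: "Q \<in> borel \<rightarrow>\<^sub>M prob_algebra borel"
    using Q by (simp add: channel_iff_measurable_prob_algebra)
  have sQ [measurable_cong]: "sets (Q x) = sets borel" for x
    using Q by (auto simp: channel_def borel_prob_def)
  have ret [measurable]:
    "(\<lambda>z. return borel z) \<in> (borel :: ('a \<times> 'b) measure) \<rightarrow>\<^sub>M prob_algebra borel"
    by (rule measurable_return_prob_space)
  have K [measurable]: "(\<lambda>x. Q x \<bind> (\<lambda>y. return borel (x, y))) \<in>
      borel \<rightarrow>\<^sub>M (prob_algebra borel :: ('a \<times> 'b) measure measure)"
    by (rule measurable_bind_prob_space2[where N = borel]) measurable
  have "(\<integral>\<^sup>+ z. h z \<partial>joint P Q)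
      = (\<integral>\<^sup>+ x. (\<integral>\<^sup>+ z. h z \<partial>(Q x \<bind> (\<lambda>y. return borel (x, y)))) \<partial>P)"
    unfolding joint_eq_bind(1)[OF P Q]
    by (rule nn_integral_bind[where B = borel])
       (use measurable_prob_algebraD[OF K] in \<open>simp_all add: measurable_cong_sets[OF sP refl]\<close>)
  also have "\<dots> = (\<integral>\<^sup>+ x. (\<integral>\<^sup>+ y. h (x, y) \<partial>Q x) \<partial>P)"
  proof (rule nn_integral_cong)
    fix x
    have "(\<lambda>y. return borel (x, y)) \<in> borel \<rightarrow>\<^sub>M (prob_algebra borel :: ('a \<times> 'b) measure measure)"
      by measurable
    from measurable_prob_algebraD[OF this]
    have "(\<integral>\<^sup>+ z. h z \<partial>(Q x \<bind> (\<lambda>y. return borel (x, y))))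
        = (\<integral>\<^sup>+ y. (\<integral>\<^sup>+ z. h z \<partial>return borel (x, y)) \<partial>Q x)"
      by (intro nn_integral_bind[where B = borel]) (simp_all add: measurable_cong_sets[OF sQ refl])
    then show "(\<integral>\<^sup>+ z. h z \<partial>(Q x \<bind> (\<lambda>y. return borel (x, y)))) = (\<integral>\<^sup>+ y. h (x, y) \<partial>Q x)"
      by (simp add: nn_integral_return)
  qed
  finally show ?thesis .
qed

lemma borel_measurable_channel_integral:
  fixes Q :: "'a::second_countable_topology \<Rightarrow> 'b::second_countable_topology measure"
  assumes Q: "channel Q" and h: "h \<in> borel_measurable borel"
  shows "(\<lambda>x. \<integral>\<^sup>+ y. h (x, y) \<partial>Q x) \<in> borel_measurable borel"
proof (rule nn_integral_measurable_subprob_algebra2)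
  show "(\<lambda>(x, y). h (x, y)) \<in> borel_measurable (borel \<Otimes>\<^sub>M borel)"
    using h by (simp add: borel_prod)
  show "Q \<in> borel \<rightarrow>\<^sub>M subprob_algebra borel"
    using Q by (simp add: channel_iff_measurable_prob_algebra measurable_prob_algebraD)
qed

lemma emeasure_joint_cylinder:
  fixes P :: "'a::second_countable_topology measure"
    and Q :: "'a \<Rightarrow> 'b::second_countable_topology measure"
  assumes P: "borel_prob P" and Q: "channel Q" and A: "A \<in> sets borel"
  shows "emeasure (joint P Q) (A \<times> UNIV) = emeasure P A"
proof -
  have sP: "sets P = sets borel"
    using P by (simp add: borel_prob_def)
  have Qx: "emeasure (Q x) UNIV = 1" for x
  proof -
    have "prob_space (Q x)" and "space (Q x) = UNIV"
      using Q sets_eq_imp_space_eq[of "Q x" borel] by (auto simp: channel_def borel_prob_def)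
    then show ?thesis using prob_space.emeasure_space_1[of "Q x"] by simp
  qed
  have "A \<times> UNIV \<in> sets (borel :: ('a \<times> 'b) measure)"
    using A by (rule sets_borel_cylinder)
  then have "emeasure (joint P Q) (A \<times> UNIV)
      = (\<integral>\<^sup>+ x. (\<integral>\<^sup>+ y. indicator (A \<times> UNIV) (x, y) \<partial>Q x) \<partial>P)"
    by (rule emeasure_joint[OF P Q])
  also have "\<dots> = (\<integral>\<^sup>+ x. indicator A x \<partial>P)"
  proof (rule nn_integral_cong)
    fix x
    have "space (Q x) = UNIV"
      using Q sets_eq_imp_space_eq[of "Q x" borel] by (auto simp: channel_def borel_prob_def)
    moreover have "indicator (A \<times> UNIV) (x, y) = (indicator A x :: ennreal)" for y :: 'b
      by (simp add: indicator_def)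
    ultimately show "(\<integral>\<^sup>+ y. indicator (A \<times> UNIV) (x, y) \<partial>Q x) = indicator A x"
      using Qx[of x] by simp
  qed
  also have "\<dots> = emeasure P A"
    using A sP by simp
  finally show ?thesis .
qed

section \<open>A channel dominating a sequence of channels\<close>

text \<open>The dominating channel is the mixture of the sequence with geometric weights; any weights
  that are all positive and sum to \<open>1\<close> would serve.\<close>

lemma ex_dominating_channel:
  fixes q :: "nat \<Rightarrow> 'a::second_countable_topology \<Rightarrow> 'b::second_countable_topology measure"
  assumes q: "\<And>n. channel (q n)"
  obtains R where "channel R"
    and "\<And>P n. borel_prob P \<Longrightarrow> absolutely_continuous (joint P R) (joint P (q n))"
proof -
  define w :: "nat pmf" where "w = geometric_pmf (1/2)"
  define R where "R x = measure_pmf w \<bind> (\<lambda>n. q n x)" for x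
  have qm [measurable]: "q n \<in> borel \<rightarrow>\<^sub>M prob_algebra borel" for n
    using q by (simp add: channel_iff_measurable_prob_algebra)
  have wsp: "measure_pmf w \<in> space (prob_algebra (count_space UNIV))"
    by (simp add: space_prob_algebra measure_pmf.prob_space_axioms)
  have R: "channel R"
    unfolding channel_iff_measurable_prob_algebra R_def
  proof (rule measurable_bind_prob_space2[where N = "count_space UNIV"])
    show "(\<lambda>x::'a. measure_pmf w) \<in> borel \<rightarrow>\<^sub>M prob_algebra (count_space UNIV)"
      using wsp by simp
    have "(\<lambda>z. q (snd z) (fst z)) \<in> (borel \<Otimes>\<^sub>M count_space UNIV) \<rightarrow>\<^sub>M prob_algebra borel"
      by (rule measurable_compose_countable) measurable
    then show "(\<lambda>(x, n). q n x) \<in> (borel \<Otimes>\<^sub>M count_space UNIV) \<rightarrow>\<^sub>M prob_algebra borel"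
      by (simp add: case_prod_beta')
  qed
  have nn: "(\<integral>\<^sup>+ y. h y \<partial>R x) = (\<integral>\<^sup>+ n. (\<integral>\<^sup>+ y. h y \<partial>q n x) \<partial>measure_pmf w)"
    if "h \<in> borel_measurable borel" for h and x
    unfolding R_def
  proof (rule nn_integral_bind[OF that])
    have "q n x \<in> space (subprob_algebra borel)" for n
      using q by (auto simp: channel_def borel_prob_def space_subprob_algebra
          intro: prob_space_imp_subprob_space)
    then show "(\<lambda>n. q n x) \<in> measure_pmf w \<rightarrow>\<^sub>M subprob_algebra borel"
      by simp
  qed
  have "absolutely_continuous (joint P R) (joint P (q n))" if P: "borel_prob P" for P n
    unfolding absolutely_continuous_def
  proof
    fix A assume "A \<in> null_sets (joint P R)"
    then have A: "A \<in> sets borel" and "emeasure (joint P R) A = 0"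
      by (auto simp: null_sets_def)
    then have z: "(\<integral>\<^sup>+ x. (\<integral>\<^sup>+ y. indicator A (x, y) \<partial>R x) \<partial>P) = 0"
      by (simp add: emeasure_joint[OF P R])
    have Ax: "(\<lambda>y. indicator A (x, y) :: ennreal) \<in> borel_measurable borel" for x
      using A by (intro borel_measurable_section) simp
    have "(\<lambda>x. \<integral>\<^sup>+ y. indicator A (x, y) \<partial>R x) \<in> borel_measurable borel"
      using borel_measurable_channel_integral[OF R, of "indicator A"] A by simp
    then have "(\<lambda>x. \<integral>\<^sup>+ y. indicator A (x, y) \<partial>R x) \<in> borel_measurable P"
      using P by (simp add: borel_prob_def cong: measurable_cong_sets)
    with z have "AE x in P. (\<integral>\<^sup>+ y. indicator A (x, y) \<partial>R x) = 0"
      by (simp add: nn_integral_0_iff_AE)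
    then have "AE x in P. (\<integral>\<^sup>+ y. indicator A (x, y) \<partial>q n x) = 0"
    proof (rule AE_mp, intro AE_I2 impI)
      fix x assume "(\<integral>\<^sup>+ y. indicator A (x, y) \<partial>R x) = 0"
      then have "AE m in measure_pmf w. (\<integral>\<^sup>+ y. indicator A (x, y) \<partial>q m x) = 0"
        by (simp add: nn[OF Ax] nn_integral_0_iff_AE)
      then show "(\<integral>\<^sup>+ y. indicator A (x, y) \<partial>q n x) = 0"
        by (simp add: AE_measure_pmf_iff w_def set_pmf_geometric)
    qed
    then have "emeasure (joint P (q n)) A = (\<integral>\<^sup>+ x. 0 \<partial>P)"
      unfolding emeasure_joint[OF P q A] by (rule nn_integral_cong_AE)
    with A show "A \<in> null_sets (joint P (q n))"
      by (simp add: null_sets_def)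
  qed
  with R show ?thesis by (rule that)
qed

section \<open>Disintegration relative to a dominating channel\<close>

text \<open>Reweighting the channel \<open>R\<close> by the Radon-Nikodym density \<open>f\<close> of \<open>\<mu>\<close> yields the conditional
  distributions of \<open>\<mu>\<close>. The marginal condition says that the normalising factor
  \<open>\<integral> f(x, y) R(dy|x)\<close> is a density of \<open>P\<close> with respect to itself, so it is \<open>1\<close> almost everywhere.\<close>

lemma joint_representation_of_absolutely_continuous:
  fixes P :: "'a::second_countable_topology measure"
    and R :: "'a \<Rightarrow> 'b::second_countable_topology measure"
  assumes P: "borel_prob P" and R: "channel R" and \<mu>: "borel_prob \<mu>"
    and ac: "absolutely_continuous (joint P R) \<mu>"
    and marginal: "\<And>A. A \<in> sets borel \<Longrightarrow> emeasure \<mu> (A \<times> UNIV) = emeasure P A"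
  obtains Q where "channel Q" and "joint P Q = \<mu>"
proof -
  have sP: "sets P = sets borel" and prP: "prob_space P"
    using P by (auto simp: borel_prob_def)
  interpret P: prob_space P by (rule prP)
  have s\<mu>: "sets \<mu> = sets borel"
    using \<mu> by (auto simp: borel_prob_def)
  have sR [measurable_cong]: "sets (R x) = sets borel" and pR: "borel_prob (R x)" for x
    using R by (auto simp: channel_def borel_prob_def)
  interpret J: prob_space "joint P R"
    using borel_prob_joint[OF P R] by (simp add: borel_prob_def)
  obtain f where f: "f \<in> borel_measurable (joint P R)" and df: "density (joint P R) f = \<mu>"
    using J.Radon_Nikodym[OF ac] s\<mu> by auto
  have fb: "f \<in> borel_measurable borel"
    using f by (simp cong: measurable_cong_sets)
  have fx: "(\<lambda>y. f (x, y)) \<in> borel_measurable borel" for x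
    using fb by (rule borel_measurable_section)
  have \<mu>_eq: "emeasure \<mu> A = (\<integral>\<^sup>+ x. (\<integral>\<^sup>+ y. f (x, y) * indicator A (x, y) \<partial>R x) \<partial>P)"
    if A: "A \<in> sets borel" for A
  proof -
    have "emeasure \<mu> A = (\<integral>\<^sup>+ z. f z * indicator A z \<partial>joint P R)"
      using f A unfolding df[symmetric] by (subst emeasure_density) auto
    also have "\<dots> = (\<integral>\<^sup>+ x. (\<integral>\<^sup>+ y. f (x, y) * indicator A (x, y) \<partial>R x) \<partial>P)"
      using fb A by (intro nn_integral_joint[OF P R]) auto
    finally show ?thesis .
  qed
  define g where "g x = (\<integral>\<^sup>+ y. f (x, y) \<partial>R x)" for x
  have g [measurable]: "g \<in> borel_measurable borel"
    unfolding g_def by (rule borel_measurable_channel_integral[OF R fb])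
  have gP: "g \<in> borel_measurable P"
    using g sP by (simp cong: measurable_cong_sets)
  have "density P g = density P (\<lambda>_. 1)"
  proof (rule measure_eqI)
    fix A assume "A \<in> sets (density P g)"
    then have A: "A \<in> sets borel" and AP: "A \<in> sets P" using sP by auto
    have "A \<times> UNIV \<in> sets (borel :: ('a \<times> 'b) measure)"
      using A by (rule sets_borel_cylinder)
    then have "emeasure P A = (\<integral>\<^sup>+ x. (\<integral>\<^sup>+ y. f (x, y) * indicator (A \<times> UNIV) (x, y) \<partial>R x) \<partial>P)"
      by (simp only: \<mu>_eq marginal[OF A, symmetric])
    also have "\<dots> = (\<integral>\<^sup>+ x. g x * indicator A x \<partial>P)"
      by (intro nn_integral_cong) (auto simp: g_def indicator_def)
    also have "\<dots> = emeasure (density P g) A"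
      using gP AP by (simp add: emeasure_density)
    finally show "emeasure (density P g) A = emeasure (density P (\<lambda>_. 1)) A"
      using AP by (simp add: emeasure_density)
  qed simp
  then have g1: "AE x in P. g x = 1"
    using gP by (subst (asm) P.density_unique_iff) auto
  define Q where "Q x = (if g x = 1 then density (R x) (\<lambda>y. f (x, y)) else R x)" for x
  have emQ: "emeasure (density (R x) (\<lambda>y. f (x, y))) A = (\<integral>\<^sup>+ y. f (x, y) * indicator A y \<partial>R x)"
    if "A \<in> sets borel" for A x
    using that fx[of x] sR[of x] by (subst emeasure_density) (auto cong: measurable_cong_sets)
  have Q: "channel Q"
    unfolding channel_def
  proof (intro conjI allI ballI)
    fix x
    show "borel_prob (Q x)"
    proof (cases "g x = 1")
      case True
      have "space (R x) = UNIV" using sets_eq_imp_space_eq[OF sR] by simp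
      then have "prob_space (density (R x) (\<lambda>y. f (x, y)))"
        using True emQ[of UNIV x] by (intro prob_spaceI) (simp add: g_def)
      with True sR show ?thesis by (simp add: Q_def borel_prob_def)
    qed (simp add: Q_def pR)
  next
    fix A :: "'b set" assume A: "A \<in> sets borel"
    have "(\<lambda>z. f z * indicator A (snd z)) \<in> borel_measurable (borel \<Otimes>\<^sub>M borel)"
      using fb A by (simp add: borel_prod[symmetric])
    then have "(\<lambda>x. \<integral>\<^sup>+ y. f (x, y) * indicator A y \<partial>R x) \<in> borel_measurable borel"
      using borel_measurable_channel_integral[OF R, of "\<lambda>z. f z * indicator A (snd z)"]
      by (simp add: borel_prod)
    moreover have "(\<lambda>x. emeasure (R x) A) \<in> borel_measurable borel"
      using R A by (simp add: channel_def)
    moreover have "(\<lambda>x. emeasure (Q x) A) = (\<lambda>x. if g x = 1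
        then \<integral>\<^sup>+ y. f (x, y) * indicator A y \<partial>R x else emeasure (R x) A)"
      using emQ[OF A] by (auto simp: Q_def)
    ultimately show "(\<lambda>x. emeasure (Q x) A) \<in> borel_measurable borel"
      by simp
  qed
  have "joint P Q = \<mu>"
  proof (rule measure_eqI)
    fix A assume "A \<in> sets (joint P Q)"
    then have A: "A \<in> sets borel" by simp
    have Ax: "(\<lambda>y. indicator A (x, y) :: ennreal) \<in> borel_measurable borel" for x
      using A by (intro borel_measurable_section) simp
    have "emeasure (joint P Q) A = (\<integral>\<^sup>+ x. (\<integral>\<^sup>+ y. indicator A (x, y) \<partial>Q x) \<partial>P)"
      by (rule emeasure_joint[OF P Q A])
    also have "\<dots> = (\<integral>\<^sup>+ x. (\<integral>\<^sup>+ y. f (x, y) * indicator A (x, y) \<partial>R x) \<partial>P)"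
    proof (rule nn_integral_cong_AE, use g1 in eventually_elim)
      fix x assume "g x = 1"
      then show "(\<integral>\<^sup>+ y. indicator A (x, y) \<partial>Q x) = (\<integral>\<^sup>+ y. f (x, y) * indicator A (x, y) \<partial>R x)"
        using fx[of x] Ax[of x] sR[of x]
        by (simp add: Q_def nn_integral_density cong: measurable_cong_sets)
    qed
    also have "\<dots> = emeasure \<mu> A"
      by (rule \<mu>_eq[OF A, symmetric])
    finally show "emeasure (joint P Q) A = emeasure \<mu> A" .
  qed (simp add: s\<mu>)
  with Q show ?thesis by (rule that)
qed

section \<open>Precompactness of the channels\<close>

text \<open>Both hypotheses of the representation lemma are properties of single sets, so they pass to the
  limit: null sets of the dominating joint measure have measure \<open>0\<close> along the sequence, and
  cylinders \<open>A \<times> UNIV\<close> have the constant measure \<open>P(A)\<close>.\<close>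

lemma tv_limit_of_joints_is_joint:
  fixes P :: "'a::second_countable_topology measure"
    and q :: "nat \<Rightarrow> 'a \<Rightarrow> 'b::second_countable_topology measure"
  assumes P: "borel_prob P" and q: "\<And>n. channel (q n)" and \<mu>: "borel_prob \<mu>"
    and lim: "(\<lambda>n. tv_dist (joint P (q n)) \<mu>) \<longlonglongrightarrow> 0"
  obtains Q where "channel Q" and "joint P Q = \<mu>"
proof -
  have setwise: "(\<lambda>n. measure (joint P (q n)) A) \<longlonglongrightarrow> measure \<mu> A" if "A \<in> sets borel" for A
    using borel_prob_joint[OF P q] \<mu> lim that by (rule tv_convergence_imp_setwise)
  interpret P: prob_space P using P by (simp add: borel_prob_def)
  interpret M: prob_space \<mu> using \<mu> by (simp add: borel_prob_def)
  have s\<mu>: "sets \<mu> = sets borel" using \<mu> by (simp add: borel_prob_def)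
  obtain R where R: "channel R"
    and dom: "\<And>n. absolutely_continuous (joint P R) (joint P (q n))"
    using ex_dominating_channel[of q, OF q] P by metis
  have "absolutely_continuous (joint P R) \<mu>"
    unfolding absolutely_continuous_def
  proof
    fix A assume A: "A \<in> null_sets (joint P R)"
    then have Ab: "A \<in> sets borel" by (simp add: null_sets_def)
    have "A \<in> null_sets (joint P (q n))" for n
      using dom[of n] A by (auto simp: absolutely_continuous_def)
    then have "measure (joint P (q n)) A = 0" for n
      by (simp add: measure_def null_sets_def)
    with setwise[OF Ab] have "measure \<mu> A = 0"
      by (simp add: LIMSEQ_const_iff)
    with Ab s\<mu> show "A \<in> null_sets \<mu>"
      by (simp add: null_sets_def M.emeasure_eq_measure)
  qed
  moreover have "emeasure \<mu> (A \<times> UNIV) = emeasure P A" if A: "A \<in> sets borel" for A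
  proof -
    have "A \<times> UNIV \<in> sets (borel :: ('a \<times> 'b) measure)"
      using A by (rule sets_borel_cylinder)
    from setwise[OF this] have "(\<lambda>n. measure P A) \<longlonglongrightarrow> measure \<mu> (A \<times> UNIV)"
      by (simp add: measure_def emeasure_joint_cylinder[OF P q A])
    then show ?thesis
      by (simp add: LIMSEQ_const_iff M.emeasure_eq_measure P.emeasure_eq_measure)
  qed
  ultimately show ?thesis
    using joint_representation_of_absolutely_continuous[OF P R \<mu>] that by blast
qed

theorem lemma4p4:
  fixes P :: "(real ^ 'n) measure"
    and \<Q> :: "(real ^ 'n \<Rightarrow> (real ^ 'm) measure) set"
  assumes "borel_prob P"
    and "\<forall>Q\<in>\<Q>. channel Q"
    and "tv_precompact {joint P Q | Q. Q \<in> \<Q>}"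
  shows "tv_precompact_at_input P \<Q>"
  unfolding tv_precompact_at_input_def
proof (intro allI impI)
  fix q :: "nat \<Rightarrow> real ^ 'n \<Rightarrow> (real ^ 'm) measure"
  assume q: "range q \<subseteq> \<Q>"
  then have "range (\<lambda>k. joint P (q k)) \<subseteq> {joint P Q | Q. Q \<in> \<Q>}"
    by auto
  with assms(3) obtain r \<mu> where r: "strict_mono r" and \<mu>: "borel_prob \<mu>"
    and lim: "(\<lambda>k. tv_dist (joint P (q (r k))) \<mu>) \<longlonglongrightarrow> 0"
    unfolding tv_precompact_def by meson
  have "channel (q (r k))" for k
    using q assms(2) by auto
  then obtain Q where "channel Q" and "joint P Q = \<mu>"
    using tv_limit_of_joints_is_joint[of P "\<lambda>k. q (r k)", OF assms(1) _ \<mu> lim] by blast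
  with r lim show "\<exists>r Q. strict_mono r \<and> channel Q \<and>
      (\<lambda>k. tv_dist (joint P (q (r k))) (joint P Q)) \<longlonglongrightarrow> 0"
    by blast
qed

end
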